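(* Let $S$ be a Po-$\Gamma$-semigroup and let $\mu : S \to [0,1]$ be a non-empty fuzzy subset of $S$. Then $\mu$ is a fuzzy characteristic interior ideal of $S$ if and only if for every $t \in [0,1]$ such that the $t$-cut $\mu_t = \{x \in S : \mu(x) \geq t\}$ is non-empty, $\mu_t$ is a characteristic interior ideal of $S$.
   Context: Let $S$ and $\Gamma$ be non-empty sets. $S$ is called a $\Gamma$-semigroup if there is a mapping $S \times \Gamma \times S \to S$, written $(a,\alpha,b) \mapsto a\alpha b$, satisfying $(a\alpha b)\beta c = a\alpha(b\beta c)$ for all $a,b,c \in S$ and all $\alpha,\beta \in \Gamma$. A Po-$\Gamma$-semigroup (partially ordered $\Gamma$-semigroup) is a $\Gamma$-semigroup $S$ equipped with a partial order $\leq$ such that for all $a,b,c \in S$ and $\gamma \in \Gamma$, $a \leq b$ implies $a\gamma c \leq b\gamma c$ and $c\gamma a \leq c\gamma b$. For subsets $A, B$ of $S$, $A\Gamma B = \{a\gamma b : a \in A, \gamma \in \Gamma, b \in B\}$. A subsemigroup of $S$ is a non-empty subset $A \subseteq S$ with $A\Gamma A \subseteq A$. A subsemigroup $A$ of $S$ is an interior ideal of $S$ if (1) $S\Gamma A\Gamma S \subseteq A$, and (2) $a \in A$, $b \in S$ and $b \leq a$ imply $b \in A$. A fuzzy subset of a set $X$ is a function $\mu : X \to [0,1]$; it is non-empty if it is not identically $0$. A non-empty fuzzy subset $\mu$ of $S$ is a fuzzy subsemigroup of $S$ if $\mu(x\gamma y) \geq \min\{\mu(x),\mu(y)\}$ for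 all $x,y \in S$ and $\gamma \in \Gamma$. A fuzzy subsemigroup $\mu$ of $S$ is a fuzzy interior ideal of $S$ if (1) $\mu(x\alpha a\beta y) \geq \mu(a)$ for all $x,a,y \in S$ and $\alpha,\beta \in \Gamma$, and (2) $x \leq y$ implies $\mu(x) \geq \mu(y)$ for all $x,y \in S$. $\mathrm{Aut}(S)$ denotes the set of all automorphisms of the Po-$\Gamma$-semigroup $S$, i.e. bijections $f : S \to S$ with $f(a\gamma b) = f(a)\gamma f(b)$ for all $a,b \in S$, $\gamma \in \Gamma$, and $a \leq b$ if and only if $f(a) \leq f(b)$. An interior ideal $A$ of $S$ is a characteristic interior ideal if $f(A) = A$ for all $f \in \mathrm{Aut}(S)$. A fuzzy interior ideal $\mu$ of $S$ is a fuzzy characteristic interior ideal if $\mu(f(x)) = \mu(x)$ for all $x \in S$ and all $f \in \mathrm{Aut}(S)$. *)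

theory Defs
  imports "HOL-Library.FuncSet" Complex_Main
begin

locale gamma_semigroup =
  fixes S :: "'a set" and \<Gamma> :: "'g set" and m :: "'a \<Rightarrow> 'g \<Rightarrow> 'a \<Rightarrow> 'a"
  assumes carrier_nonempty: "S \<noteq> {}"
    and index_nonempty: "\<Gamma> \<noteq> {}"
    and closed: "\<lbrakk>a \<in> S; \<alpha> \<in> \<Gamma>; b \<in> S\<rbrakk> \<Longrightarrow> m a \<alpha> b \<in> S"
    and assoc: "\<lbrakk>a \<in> S; b \<in> S; c \<in> S; \<alpha> \<in> \<Gamma>; \<beta> \<in> \<Gamma>\<rbrakk>
      \<Longrightarrow> m (m a \<alpha> b) \<beta> c = m a \<alpha> (m b \<beta> c)"

text \<open>The order is given by its graph: \<open>(a, b) \<in> r\<close> means \<open>a \<le> b\<close>.\<close>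

locale po_gamma_semigroup = gamma_semigroup S \<Gamma> m
  for S :: "'a set" and \<Gamma> :: "'g set" and m :: "'a \<Rightarrow> 'g \<Rightarrow> 'a \<Rightarrow> 'a" +
  fixes r :: "'a rel"
  assumes order: "partial_order_on S r"
    and mono_right: "\<lbrakk>(a, b) \<in> r; c \<in> S; \<gamma> \<in> \<Gamma>\<rbrakk> \<Longrightarrow> (m a \<gamma> c, m b \<gamma> c) \<in> r"
    and mono_left: "\<lbrakk>(a, b) \<in> r; c \<in> S; \<gamma> \<in> \<Gamma>\<rbrakk> \<Longrightarrow> (m c \<gamma> a, m c \<gamma> b) \<in> r"

definition set_gmult ::
  "'g set \<Rightarrow> ('a \<Rightarrow> 'g \<Rightarrow> 'a \<Rightarrow> 'a) \<Rightarrow> 'a set \<Rightarrow> 'a set \<Rightarrow> 'a set" where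
  "set_gmult \<Gamma> m A B = {m a \<gamma> b | a \<gamma> b. a \<in> A \<and> \<gamma> \<in> \<Gamma> \<and> b \<in> B}"

definition subsemigroup ::
  "'a set \<Rightarrow> 'g set \<Rightarrow> ('a \<Rightarrow> 'g \<Rightarrow> 'a \<Rightarrow> 'a) \<Rightarrow> 'a set \<Rightarrow> bool" where
  "subsemigroup S \<Gamma> m A \<longleftrightarrow> A \<noteq> {} \<and> A \<subseteq> S \<and> set_gmult \<Gamma> m A A \<subseteq> A"

definition interior_ideal ::
  "'a set \<Rightarrow> 'g set \<Rightarrow> ('a \<Rightarrow> 'g \<Rightarrow> 'a \<Rightarrow> 'a) \<Rightarrow> 'a rel \<Rightarrow> 'a set \<Rightarrow> bool" where
  "interior_ideal S \<Gamma> m r A \<longleftrightarrow>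
     subsemigroup S \<Gamma> m A \<and>
     set_gmult \<Gamma> m (set_gmult \<Gamma> m S A) S \<subseteq> A \<and>
     (\<forall>a\<in>A. \<forall>b\<in>S. (b, a) \<in> r \<longrightarrow> b \<in> A)"

text \<open>Automorphisms are functions on the whole type, of which only the values on \<open>S\<close> matter.\<close>

definition Aut ::
  "'a set \<Rightarrow> 'g set \<Rightarrow> ('a \<Rightarrow> 'g \<Rightarrow> 'a \<Rightarrow> 'a) \<Rightarrow> 'a rel \<Rightarrow> ('a \<Rightarrow> 'a) set" where
  "Aut S \<Gamma> m r = {f. bij_betw f S S \<and>
     (\<forall>a\<in>S. \<forall>b\<in>S. \<forall>\<gamma>\<in>\<Gamma>. f (m a \<gamma> b) = m (f a) \<gamma> (f b)) \<and>
     (\<forall>a\<in>S. \<forall>b\<in>S. (a, b) \<in> r \<longleftrightarrow> (f a, f b) \<in> r)}"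

definition characteristic_interior_ideal ::
  "'a set \<Rightarrow> 'g set \<Rightarrow> ('a \<Rightarrow> 'g \<Rightarrow> 'a \<Rightarrow> 'a) \<Rightarrow> 'a rel \<Rightarrow> 'a set \<Rightarrow> bool" where
  "characteristic_interior_ideal S \<Gamma> m r A \<longleftrightarrow>
     interior_ideal S \<Gamma> m r A \<and> (\<forall>f\<in>Aut S \<Gamma> m r. f ` A = A)"

text \<open>A fuzzy subset of \<open>X\<close> is likewise a function on the whole type, considered on \<open>X\<close> only.\<close>

definition fuzzy_subset :: "'a set \<Rightarrow> ('a \<Rightarrow> real) \<Rightarrow> bool" where
  "fuzzy_subset X \<mu> \<longleftrightarrow> \<mu> \<in> X \<rightarrow> {0..1}"

definition nonempty_fuzzy_subset :: "'a set \<Rightarrow> ('a \<Rightarrow> real) \<Rightarrow> bool" where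
  "nonempty_fuzzy_subset X \<mu> \<longleftrightarrow> fuzzy_subset X \<mu> \<and> (\<exists>x\<in>X. \<mu> x \<noteq> 0)"

definition t_cut :: "'a set \<Rightarrow> ('a \<Rightarrow> real) \<Rightarrow> real \<Rightarrow> 'a set" where
  "t_cut X \<mu> t = {x \<in> X. \<mu> x \<ge> t}"

definition fuzzy_subsemigroup ::
  "'a set \<Rightarrow> 'g set \<Rightarrow> ('a \<Rightarrow> 'g \<Rightarrow> 'a \<Rightarrow> 'a) \<Rightarrow> ('a \<Rightarrow> real) \<Rightarrow> bool" where
  "fuzzy_subsemigroup S \<Gamma> m \<mu> \<longleftrightarrow>
     nonempty_fuzzy_subset S \<mu> \<and>
     (\<forall>x\<in>S. \<forall>y\<in>S. \<forall>\<gamma>\<in>\<Gamma>. \<mu> (m x \<gamma> y) \<ge> min (\<mu> x) (\<mu> y))"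

definition fuzzy_interior_ideal ::
  "'a set \<Rightarrow> 'g set \<Rightarrow> ('a \<Rightarrow> 'g \<Rightarrow> 'a \<Rightarrow> 'a) \<Rightarrow> 'a rel \<Rightarrow> ('a \<Rightarrow> real) \<Rightarrow> bool" where
  "fuzzy_interior_ideal S \<Gamma> m r \<mu> \<longleftrightarrow>
     fuzzy_subsemigroup S \<Gamma> m \<mu> \<and>
     (\<forall>x\<in>S. \<forall>a\<in>S. \<forall>y\<in>S. \<forall>\<alpha>\<in>\<Gamma>. \<forall>\<beta>\<in>\<Gamma>. \<mu> (m (m x \<alpha> a) \<beta> y) \<ge> \<mu> a) \<and>
     (\<forall>x\<in>S. \<forall>y\<in>S. (x, y) \<in> r \<longrightarrow> \<mu> x \<ge> \<mu> y)"

definition fuzzy_characteristic_interior_ideal ::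
  "'a set \<Rightarrow> 'g set \<Rightarrow> ('a \<Rightarrow> 'g \<Rightarrow> 'a \<Rightarrow> 'a) \<Rightarrow> 'a rel \<Rightarrow> ('a \<Rightarrow> real) \<Rightarrow> bool" where
  "fuzzy_characteristic_interior_ideal S \<Gamma> m r \<mu> \<longleftrightarrow>
     fuzzy_interior_ideal S \<Gamma> m r \<mu> \<and> (\<forall>x\<in>S. \<forall>f\<in>Aut S \<Gamma> m r. \<mu> (f x) = \<mu> x)"

end

theory Submission
  imports Defs
begin

text \<open>An inequality \<open>\<mu> a \<le> \<mu> b\<close> between values on the carrier says
  that every cut containing \<open>a\<close> contains \<open>b\<close>, so each fuzzy axiom is the
  matching closure property of all cuts at once. From \<mu> to its cuts this is transitivity of the
  order on the reals (\<open>interior_ideal_t_cut\<close>). Conversely, an inequality is recovered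
  from the single cut whose level is its smaller side
  (\<open>fuzzy_interior_ideal_if_t_cuts\<close>); that level lies in the unit interval and its cut
  is visibly non-empty. Invariance under an automorphism transfers in the same way
  (\<open>image_t_cut_eq\<close>, \<open>invariant_if_image_t_cuts\<close>), with surjectivity used
  in one direction and injectivity in the other.\<close>

lemma mem_t_cut [simp]: "x \<in> t_cut X \<mu> t \<longleftrightarrow> x \<in> X \<and> t \<le> \<mu> x"
  by (simp add: t_cut_def)

lemma set_gmult_subset_iff:
  "set_gmult \<Gamma> m A B \<subseteq> C \<longleftrightarrow> (\<forall>a\<in>A. \<forall>\<gamma>\<in>\<Gamma>. \<forall>b\<in>B. m a \<gamma> b \<in> C)"
  by (auto simp: set_gmult_def)

lemma set_gmult_set_gmult_subset_iff:
  "set_gmult \<Gamma> m (set_gmult \<Gamma> m A B) C \<subseteq> D \<longleftrightarrow>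
    (\<forall>a\<in>A. \<forall>\<alpha>\<in>\<Gamma>. \<forall>b\<in>B. \<forall>\<beta>\<in>\<Gamma>. \<forall>c\<in>C. m (m a \<alpha> b) \<beta> c \<in> D)"
  by (auto simp: set_gmult_def) blast

text \<open>Each closure property chains \<open>t \<le> ...\<close> with one inequality for \<mu>.
  That products stay in the carrier, as membership in a cut demands, comes from
  \<open>closed\<close>.\<close>

lemma (in gamma_semigroup) interior_ideal_t_cut:
  assumes "fuzzy_interior_ideal S \<Gamma> m r \<mu>" and "t_cut S \<mu> t \<noteq> {}"
  shows "interior_ideal S \<Gamma> m r (t_cut S \<mu> t)"
proof -
  have mul: "min (\<mu> x) (\<mu> y) \<le> \<mu> (m x \<gamma> y)" if "x \<in> S" "y \<in> S" "\<gamma> \<in> \<Gamma>" for x y \<gamma>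
    using assms(1) that unfolding fuzzy_interior_ideal_def fuzzy_subsemigroup_def by blast
  have int: "\<mu> a \<le> \<mu> (m (m x \<alpha> a) \<beta> y)"
    if "x \<in> S" "a \<in> S" "y \<in> S" "\<alpha> \<in> \<Gamma>" "\<beta> \<in> \<Gamma>" for x a y \<alpha> \<beta>
    using assms(1) that unfolding fuzzy_interior_ideal_def by blast
  have anti: "\<mu> y \<le> \<mu> x" if "x \<in> S" "y \<in> S" "(x, y) \<in> r" for x y
    using assms(1) that unfolding fuzzy_interior_ideal_def by blast
  have "t \<le> \<mu> (m x \<gamma> y)" if "x \<in> S" "y \<in> S" "\<gamma> \<in> \<Gamma>" "t \<le> \<mu> x" "t \<le> \<mu> y" for x y \<gamma>
    using mul[OF that(1-3)] that(4,5) by linarith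
  then have "subsemigroup S \<Gamma> m (t_cut S \<mu> t)"
    using assms(2) by (auto simp: subsemigroup_def set_gmult_subset_iff closed)
  moreover have "set_gmult \<Gamma> m (set_gmult \<Gamma> m S (t_cut S \<mu> t)) S \<subseteq> t_cut S \<mu> t"
    by (auto simp: set_gmult_set_gmult_subset_iff closed intro: order_trans[OF _ int])
  moreover have "\<forall>a\<in>t_cut S \<mu> t. \<forall>b\<in>S. (b, a) \<in> r \<longrightarrow> b \<in> t_cut S \<mu> t"
    by (auto intro: order_trans[OF _ anti])
  ultimately show ?thesis
    by (simp add: interior_ideal_def)
qed

text \<open>The levels to test are \<open>min (\<mu> x) (\<mu> y)\<close> for products,
  \<open>\<mu> a\<close> for the interior condition and \<open>\<mu> y\<close> for the order
  condition.\<close>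

lemma fuzzy_interior_ideal_if_t_cuts:
  assumes ne: "nonempty_fuzzy_subset S \<mu>"
    and cut: "\<And>t. \<lbrakk>t \<in> {0..1}; t_cut S \<mu> t \<noteq> {}\<rbrakk> \<Longrightarrow> interior_ideal S \<Gamma> m r (t_cut S \<mu> t)"
  shows "fuzzy_interior_ideal S \<Gamma> m r \<mu>"
proof -
  have range: "\<mu> x \<in> {0..1}" if "x \<in> S" for x
    using ne that by (auto simp: nonempty_fuzzy_subset_def fuzzy_subset_def)
  \<comment> \<open>The point \<open>x\<close> witnesses that the cut is non-empty.\<close>
  have ideal: "interior_ideal S \<Gamma> m r (t_cut S \<mu> t)" if "x \<in> S" "t \<le> \<mu> x" "t \<in> {0..1}" for x t
    using cut[OF that(3)] that(1,2) mem_t_cut[of x S \<mu> t] by blast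
  have "min (\<mu> x) (\<mu> y) \<le> \<mu> (m x \<gamma> y)" if "x \<in> S" "y \<in> S" "\<gamma> \<in> \<Gamma>" for x y \<gamma>
  proof -
    \<comment> \<open>The minimum is the highest level whose cut contains both \<open>x\<close> and
      \<open>y\<close>.\<close>
    have "min (\<mu> x) (\<mu> y) \<in> {0..1}"
      using range[OF that(1)] range[OF that(2)] by (auto simp: min_def)
    from ideal[OF that(1) _ this] show ?thesis
      using that by (auto simp: interior_ideal_def subsemigroup_def set_gmult_subset_iff)
  qed
  moreover have "\<mu> a \<le> \<mu> (m (m x \<alpha> a) \<beta> y)"
    if "x \<in> S" "a \<in> S" "y \<in> S" "\<alpha> \<in> \<Gamma>" "\<beta> \<in> \<Gamma>" for x a y \<alpha> \<beta>
    using ideal[OF that(2) order_refl range[OF that(2)]] that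
    by (auto simp: interior_ideal_def set_gmult_set_gmult_subset_iff)
  moreover have "\<mu> y \<le> \<mu> x" if "x \<in> S" "y \<in> S" "(x, y) \<in> r" for x y
    using ideal[OF that(2) order_refl range[OF that(2)]] that by (auto simp: interior_ideal_def)
  ultimately show ?thesis
    using ne by (simp add: fuzzy_interior_ideal_def fuzzy_subsemigroup_def)
qed

text \<open>Invariance keeps images in the cut; surjectivity gives each point of the cut a preimage,
  which has the same value and so lies in the cut as well.\<close>

lemma image_t_cut_eq:
  assumes "bij_betw f X X" and "\<And>x. x \<in> X \<Longrightarrow> \<mu> (f x) = \<mu> x"
  shows "f ` t_cut X \<mu> t = t_cut X \<mu> t"
proof -
  have "t_cut X \<mu> t \<subseteq> f ` t_cut X \<mu> t"
  proof
    fix y assume y: "y \<in> t_cut X \<mu> t"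
    then obtain x where "x \<in> X" "y = f x"
      using bij_betw_imp_surj_on[OF assms(1)] by auto
    with y assms(2) show "y \<in> f ` t_cut X \<mu> t" by auto
  qed
  moreover have "f ` t_cut X \<mu> t \<subseteq> t_cut X \<mu> t"
    using assms by (auto dest: bij_betwE)
  ultimately show ?thesis by blast
qed

text \<open>One level serves each inequality: the cut at \<open>\<mu> x\<close> cannot lose
  \<open>f x\<close>, and the cut at \<open>\<mu> (f x)\<close> can reach \<open>f x\<close> only
  from \<open>x\<close>.\<close>

lemma invariant_if_image_t_cuts:
  assumes bij: "bij_betw f X X" and x: "x \<in> X"
    and "f ` t_cut X \<mu> (\<mu> x) = t_cut X \<mu> (\<mu> x)"
    and "f ` t_cut X \<mu> (\<mu> (f x)) = t_cut X \<mu> (\<mu> (f x))"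
  shows "\<mu> (f x) = \<mu> x"
proof (rule antisym)
  have "f x \<in> X" using bij x by (auto dest: bij_betwE)
  then have "f x \<in> f ` t_cut X \<mu> (\<mu> (f x))" using assms(4) by simp
  then obtain z where "z \<in> X" "\<mu> (f x) \<le> \<mu> z" "f x = f z" by auto
  \<comment> \<open>Injectivity on \<open>X\<close> forces \<open>z = x\<close>, so \<open>x\<close>
    itself lies in the cut at level \<open>\<mu> (f x)\<close>.\<close>
  then show "\<mu> (f x) \<le> \<mu> x"
    using inj_onD[OF bij_betw_imp_inj_on[OF bij]] x by metis
  have "f x \<in> f ` t_cut X \<mu> (\<mu> x)" using x by simp
  then show "\<mu> x \<le> \<mu> (f x)" using assms(3) by simp
qed

theorem theorem3p3:
  fixes S :: "'a set" and \<Gamma> :: "'g set" and m :: "'a \<Rightarrow> 'g \<Rightarrow> 'a \<Rightarrow> 'a"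
    and r :: "'a rel" and \<mu> :: "'a \<Rightarrow> real"
  assumes "po_gamma_semigroup S \<Gamma> m r"
    and "nonempty_fuzzy_subset S \<mu>"
  shows "fuzzy_characteristic_interior_ideal S \<Gamma> m r \<mu> \<longleftrightarrow>
    (\<forall>t\<in>{0..1}. t_cut S \<mu> t \<noteq> {} \<longrightarrow> characteristic_interior_ideal S \<Gamma> m r (t_cut S \<mu> t))"
proof
  interpret po_gamma_semigroup S \<Gamma> m r by fact
  assume "fuzzy_characteristic_interior_ideal S \<Gamma> m r \<mu>"
  then show "\<forall>t\<in>{0..1}. t_cut S \<mu> t \<noteq> {} \<longrightarrow>
      characteristic_interior_ideal S \<Gamma> m r (t_cut S \<mu> t)"
    by (simp add: fuzzy_characteristic_interior_ideal_def characteristic_interior_ideal_def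
        interior_ideal_t_cut image_t_cut_eq Aut_def)
next
  assume cut: "\<forall>t\<in>{0..1}. t_cut S \<mu> t \<noteq> {} \<longrightarrow>
      characteristic_interior_ideal S \<Gamma> m r (t_cut S \<mu> t)"
  have image: "f ` t_cut S \<mu> (\<mu> x) = t_cut S \<mu> (\<mu> x)" if "x \<in> S" "f \<in> Aut S \<Gamma> m r" for x f
  proof -
    have "\<mu> x \<in> {0..1}"
      using assms(2) that(1) by (auto simp: nonempty_fuzzy_subset_def fuzzy_subset_def)
    moreover have "x \<in> t_cut S \<mu> (\<mu> x)" using that(1) by simp
    ultimately show ?thesis
      using cut that(2) unfolding characteristic_interior_ideal_def by blast
  qed
  have "\<mu> (f x) = \<mu> x" if "x \<in> S" "f \<in> Aut S \<Gamma> m r" for x f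
  proof -
    have bij: "bij_betw f S S" using that(2) by (simp add: Aut_def)
    \<comment> \<open>This lets \<open>image\<close> be applied at \<open>f x\<close> as well as at
      \<open>x\<close>, supplying both levels.\<close>
    then have "f x \<in> S" using that(1) by (auto dest: bij_betwE)
    then show ?thesis
      by (intro invariant_if_image_t_cuts[OF bij that(1)] image that)
  qed
  moreover have "fuzzy_interior_ideal S \<Gamma> m r \<mu>"
    using cut by (intro fuzzy_interior_ideal_if_t_cuts[OF assms(2)])
      (simp add: characteristic_interior_ideal_def)
  ultimately show "fuzzy_characteristic_interior_ideal S \<Gamma> m r \<mu>"
    by (simp add: fuzzy_characteristic_interior_ideal_def)
qed

end
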